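(* Let $n\ge 2$, let $(X,\|\cdot\|)$ be a normed linear space over $\mathbb{K}$ ($\mathbb{K}=\mathbb{R}$ or $\mathbb{C}$), $\mathbf{a}=(a_1,\dots,a_n)\in\mathbb{K}^n$, $\mathbf{p}=(p_1,\dots,p_n)\in\mathbb{R}^n$ and $\mathbf{x}=(x_1,\dots,x_n)\in X^n$. Assume $P_i\ne0$ and $\overline{P}_i\neq0$ for all $i\in\{1,\dots,n-1\}$, and put $$F_i:=\frac{\overline{A}_i(\mathbf{p})}{\overline{P}_i}-\frac{A_i(\mathbf{p})}{P_i},\qquad i\in\{1,\dots,n-1\}.$$ Then the following three inequalities hold: (i) $\displaystyle \|T_n(\mathbf{p};\mathbf{a},\mathbf{x})\|\le \max_{1\le i\le n-1}|F_i|\cdot\sum_{i=1}^{n-1}|P_i||\overline{P}_i|\,\|\Delta x_i\|$; (ii) for all real $p>1$ and $q$ with $\frac1p+\frac1q=1$, $\displaystyle \|T_n(\mathbf{p};\mathbf{a},\mathbf{x})\|\le \Big(\sum_{i=1}^{n-1}|P_i||\overline{P}_i||F_i|^q\Big)^{1/q}\Big(\sum_{i=1}^{n-1}|P_i||\overline{P}_i|\,\|\Delta x_i\|^p\Big)^{1/p}$; (iii) $\displaystyle \|T_n(\mathbf{p};\mathbf{a},\mathbf{x})\|\le \sum_{i=1}^{n-1}|P_i||\overline{P}_i||F_i|\cdot\max_{1\le i\le n-1}\|\Delta x_i\|$. In particular (case $p_i=\frac1n$ for all $i$), with $G_i:=\frac1{n-i}\sum_{k=i+1}^n a_k-\frac1i\sum_{k=1}^i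 a_k$ for $1\le i\le n-1$: (i') $\displaystyle \|T_n(\mathbf{a},\mathbf{x})\|\le \frac1{n^2}\max_{1\le i\le n-1}|G_i|\cdot\sum_{i=1}^{n-1}i(n-i)\|\Delta x_i\|$; (ii') for all real $p>1$ and $q$ with $\frac1p+\frac1q=1$, $\displaystyle \|T_n(\mathbf{a},\mathbf{x})\|\le \frac1{n^2}\Big(\sum_{i=1}^{n-1}i(n-i)|G_i|^q\Big)^{1/q}\Big(\sum_{i=1}^{n-1}i(n-i)\|\Delta x_i\|^p\Big)^{1/p}$; (iii') $\displaystyle \|T_n(\mathbf{a},\mathbf{x})\|\le \frac1{n^2}\sum_{i=1}^{n-1}i(n-i)|G_i|\cdot\max_{1\le i\le n-1}\|\Delta x_i\|$. Moreover, each of these six inequalities is sharp in the sense that the constant $1$ multiplying its right-hand side cannot be replaced by a smaller constant.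
   Context: The Čebyšev functional is $T_n(\mathbf{p};\mathbf{a},\mathbf{x}):=P_n\sum_{i=1}^n p_ia_ix_i-\left(\sum_{i=1}^n p_ia_i\right)\cdot\sum_{i=1}^n p_ix_i$, and its unweighted version is $T_n(\mathbf{a},\mathbf{x}):=\frac1n\sum_{i=1}^n a_ix_i-\frac1n\sum_{i=1}^n a_i\cdot\frac1n\sum_{i=1}^n x_i$. Notation: $P_i:=\sum_{k=1}^i p_k$ and $A_i(\mathbf{p}):=\sum_{k=1}^i p_ka_k$ for $1\le i\le n$; $\overline{P}_i:=P_n-P_i$, $\overline{A}_i(\mathbf{p}):=A_n(\mathbf{p})-A_i(\mathbf{p})$ and $\Delta x_i:=x_{i+1}-x_i$ for $1\le i\le n-1$. The bold $\mathbf{p}$ is the weight tuple; the exponent $p$ is unrelated to it. Sharpness of an inequality $\|T_n\|\le R$ (with $p,q$ fixed, in the cases (ii), (ii')) means: if $C>0$ is a constant such that $\|T_n\|\le C\,R$ for all $n\ge2$, all normed spaces $X$ and all admissible data ($\mathbf{p},\mathbf{a},\mathbf{x}$, or $\mathbf{a},\mathbf{x}$ in the unweighted case), then $C\ge1$. *)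

theory Defs
  imports Complex_Main "HOL-Library.FuncSet" "HOL-Algebra.Module"
begin

text \<open>
  The scalar field \<open>K\<close> is \<open>\<real>\<close> or \<open>\<complex>\<close>, given as the subset \<open>\<real>\<close> or \<open>UNIV\<close> of the type
  \<^typ>\<open>complex\<close>. Vector spaces are modules in the sense of \<^theory>\<open>HOL-Algebra.Module\<close> over
  this field; the record fields for multiplication and unit of \<open>X\<close> play no role. Normed
  spaces have explicit carriers (rather than being types) because sharpness is a statement
  that quantifies over all normed spaces inside a formula.
\<close>

definition scalar_field :: "complex set \<Rightarrow> complex ring" where
  "scalar_field K = \<lparr>carrier = K, mult = (*), one = 1, zero = 0, add = (+)\<rparr>"

locale normed_space_over = module "scalar_field K" X
  for K :: "complex set" and X :: "(complex, 'v) module" (structure) +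
  fixes nrm :: "'v \<Rightarrow> real"
  assumes real_or_complex: "K = \<real> \<or> K = UNIV"
    and nrm_nonneg: "x \<in> carrier X \<Longrightarrow> 0 \<le> nrm x"
    and nrm_eq_0_iff: "x \<in> carrier X \<Longrightarrow> nrm x = 0 \<longleftrightarrow> x = \<zero>\<^bsub>X\<^esub>"
    and nrm_smult: "c \<in> K \<Longrightarrow> x \<in> carrier X \<Longrightarrow> nrm (c \<odot>\<^bsub>X\<^esub> x) = cmod c * nrm x"
    and nrm_triangle:
      "x \<in> carrier X \<Longrightarrow> y \<in> carrier X \<Longrightarrow> nrm (x \<oplus>\<^bsub>X\<^esub> y) \<le> nrm x + nrm y"

text \<open>
  An \<open>n\<close>-tuple is a function on \<^typ>\<open>nat\<close> of which only the values at \<open>1, \<dots>, n\<close> are used.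
  The weights are called \<open>w\<close>, to keep \<open>p\<close> and \<open>q\<close> for the exponents.
\<close>

definition P :: "(nat \<Rightarrow> real) \<Rightarrow> nat \<Rightarrow> real" where
  "P w i = (\<Sum>k=1..i. w k)"

definition P_bar :: "nat \<Rightarrow> (nat \<Rightarrow> real) \<Rightarrow> nat \<Rightarrow> real" where
  "P_bar n w i = P w n - P w i"

definition A :: "(nat \<Rightarrow> real) \<Rightarrow> (nat \<Rightarrow> complex) \<Rightarrow> nat \<Rightarrow> complex" where
  "A w a i = (\<Sum>k=1..i. of_real (w k) * a k)"

definition A_bar :: "nat \<Rightarrow> (nat \<Rightarrow> real) \<Rightarrow> (nat \<Rightarrow> complex) \<Rightarrow> nat \<Rightarrow> complex" where
  "A_bar n w a i = A w a n - A w a i"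

definition Delta :: "(complex, 'v) module \<Rightarrow> (nat \<Rightarrow> 'v) \<Rightarrow> nat \<Rightarrow> 'v" where
  "Delta X x i = x (i + 1) \<ominus>\<^bsub>X\<^esub> x i"

definition T_weighted ::
  "(complex, 'v) module \<Rightarrow> nat \<Rightarrow> (nat \<Rightarrow> real) \<Rightarrow> (nat \<Rightarrow> complex) \<Rightarrow> (nat \<Rightarrow> 'v) \<Rightarrow> 'v" where
  "T_weighted X n w a x =
     of_real (P w n) \<odot>\<^bsub>X\<^esub> (\<Oplus>\<^bsub>X\<^esub>i\<in>{1..n}. (of_real (w i) * a i) \<odot>\<^bsub>X\<^esub> x i)
     \<ominus>\<^bsub>X\<^esub> (\<Sum>i=1..n. of_real (w i) * a i) \<odot>\<^bsub>X\<^esub> (\<Oplus>\<^bsub>X\<^esub>i\<in>{1..n}. of_real (w i) \<odot>\<^bsub>X\<^esub> x i)"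

definition T_unweighted ::
  "(complex, 'v) module \<Rightarrow> nat \<Rightarrow> (nat \<Rightarrow> complex) \<Rightarrow> (nat \<Rightarrow> 'v) \<Rightarrow> 'v" where
  "T_unweighted X n a x =
     (1 / of_nat n) \<odot>\<^bsub>X\<^esub> (\<Oplus>\<^bsub>X\<^esub>i\<in>{1..n}. a i \<odot>\<^bsub>X\<^esub> x i)
     \<ominus>\<^bsub>X\<^esub> (1 / of_nat n * (\<Sum>i=1..n. a i)) \<odot>\<^bsub>X\<^esub> ((1 / of_nat n) \<odot>\<^bsub>X\<^esub> (\<Oplus>\<^bsub>X\<^esub>i\<in>{1..n}. x i))"

definition F :: "nat \<Rightarrow> (nat \<Rightarrow> real) \<Rightarrow> (nat \<Rightarrow> complex) \<Rightarrow> nat \<Rightarrow> complex" where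
  "F n w a i = A_bar n w a i / of_real (P_bar n w i) - A w a i / of_real (P w i)"

definition G :: "nat \<Rightarrow> (nat \<Rightarrow> complex) \<Rightarrow> nat \<Rightarrow> complex" where
  "G n a i = 1 / of_nat (n - i) * (\<Sum>k=i+1..n. a k) - 1 / of_nat i * (\<Sum>k=1..i. a k)"

definition nondegenerate :: "nat \<Rightarrow> (nat \<Rightarrow> real) \<Rightarrow> bool" where
  "nondegenerate n w \<longleftrightarrow> (\<forall>i\<in>{1..n-1}. P w i \<noteq> 0 \<and> P_bar n w i \<noteq> 0)"

text \<open>The right-hand sides of the six inequalities.\<close>

type_synonym 'v weighted_bound =
  "(complex, 'v) module \<Rightarrow> ('v \<Rightarrow> real) \<Rightarrow> nat \<Rightarrow> (nat \<Rightarrow> real) \<Rightarrow> (nat \<Rightarrow> complex) \<Rightarrow> (nat \<Rightarrow> 'v) \<Rightarrow> real"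

type_synonym 'v unweighted_bound =
  "(complex, 'v) module \<Rightarrow> ('v \<Rightarrow> real) \<Rightarrow> nat \<Rightarrow> (nat \<Rightarrow> complex) \<Rightarrow> (nat \<Rightarrow> 'v) \<Rightarrow> real"

definition weighted_max_sum :: "'v weighted_bound" where
  "weighted_max_sum X nrm n w a x =
     (MAX i\<in>{1..n-1}. cmod (F n w a i)) *
     (\<Sum>i=1..n-1. \<bar>P w i\<bar> * \<bar>P_bar n w i\<bar> * nrm (Delta X x i))"

definition weighted_Hoelder :: "real \<Rightarrow> real \<Rightarrow> 'v weighted_bound" where
  "weighted_Hoelder p q X nrm n w a x =
     (\<Sum>i=1..n-1. \<bar>P w i\<bar> * \<bar>P_bar n w i\<bar> * cmod (F n w a i) powr q) powr (1 / q) *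
     (\<Sum>i=1..n-1. \<bar>P w i\<bar> * \<bar>P_bar n w i\<bar> * nrm (Delta X x i) powr p) powr (1 / p)"

definition weighted_sum_max :: "'v weighted_bound" where
  "weighted_sum_max X nrm n w a x =
     (\<Sum>i=1..n-1. \<bar>P w i\<bar> * \<bar>P_bar n w i\<bar> * cmod (F n w a i)) *
     (MAX i\<in>{1..n-1}. nrm (Delta X x i))"

definition unweighted_max_sum :: "'v unweighted_bound" where
  "unweighted_max_sum X nrm n a x =
     1 / (real n)\<^sup>2 * (MAX i\<in>{1..n-1}. cmod (G n a i)) *
     (\<Sum>i=1..n-1. real i * real (n - i) * nrm (Delta X x i))"

definition unweighted_Hoelder :: "real \<Rightarrow> real \<Rightarrow> 'v unweighted_bound" where
  "unweighted_Hoelder p q X nrm n a x =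
     1 / (real n)\<^sup>2 *
     (\<Sum>i=1..n-1. real i * real (n - i) * cmod (G n a i) powr q) powr (1 / q) *
     (\<Sum>i=1..n-1. real i * real (n - i) * nrm (Delta X x i) powr p) powr (1 / p)"

definition unweighted_sum_max :: "'v unweighted_bound" where
  "unweighted_sum_max X nrm n a x =
     1 / (real n)\<^sup>2 * (\<Sum>i=1..n-1. real i * real (n - i) * cmod (G n a i)) *
     (MAX i\<in>{1..n-1}. nrm (Delta X x i))"

text \<open>
  Sharpness of \<open>\<parallel>T\<parallel> \<le> R\<close>: a constant \<open>C > 0\<close> with \<open>\<parallel>T\<parallel> \<le> C R\<close> for all \<open>n \<ge> 2\<close>, all normed
  spaces and all admissible data is at least \<open>1\<close>. HOL has no quantifier over types, so the normed
  spaces range over all subsets of the fixed type \<^typ>\<open>nat \<Rightarrow> complex\<close> with arbitrary operations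
  and norms. This loses nothing: both sides depend only on the span of \<open>x\<^sub>1, \<dots>, x\<^sub>n\<close>, and any
  finite-dimensional normed space over \<open>K\<close>, having at most the cardinality of the continuum, is
  isometrically isomorphic to one whose carrier is such a subset.
\<close>

definition sharp_weighted :: "complex set \<Rightarrow> (nat \<Rightarrow> complex) weighted_bound \<Rightarrow> bool" where
  "sharp_weighted K R \<longleftrightarrow>
     (\<forall>C>0.
       (\<forall>n\<ge>2. \<forall>X nrm. normed_space_over K X nrm \<longrightarrow>
          (\<forall>w. nondegenerate n w \<longrightarrow>
            (\<forall>a\<in>{1..n} \<rightarrow> K. \<forall>x\<in>{1..n} \<rightarrow> carrier X.
               nrm (T_weighted X n w a x) \<le> C * R X nrm n w a x)))
       \<longrightarrow> C \<ge> 1)"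

definition sharp_unweighted :: "complex set \<Rightarrow> (nat \<Rightarrow> complex) unweighted_bound \<Rightarrow> bool" where
  "sharp_unweighted K R \<longleftrightarrow>
     (\<forall>C>0.
       (\<forall>n\<ge>2. \<forall>X nrm. normed_space_over K X nrm \<longrightarrow>
          (\<forall>a\<in>{1..n} \<rightarrow> K. \<forall>x\<in>{1..n} \<rightarrow> carrier X.
             nrm (T_unweighted X n a x) \<le> C * R X nrm n a x))
       \<longrightarrow> C \<ge> 1)"

end

theory Submission
  imports Defs "HOL-Analysis.Convex"
begin

text \<open>
  With \<open>d\<^sub>i = P\<^sub>n w\<^sub>i a\<^sub>i - A\<^sub>n w\<^sub>i\<close> the functional is \<open>T = \<Sum> d\<^sub>i x\<^sub>i\<close>, and the \<open>d\<^sub>i\<close> add up to zero.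
  Summation by parts therefore leaves no boundary term and turns \<open>T\<close> into a combination of the
  differences \<open>\<Delta>x\<^sub>i\<close> with coefficients \<open>P\<^sub>i A\<^sub>n - P\<^sub>n A\<^sub>i\<close>. Since \<open>A\<^sub>n\<close> and \<open>P\<^sub>n\<close> split into the parts up to
  and beyond \<open>i\<close>, this coefficient is exactly \<open>P\<^sub>i\<close> times \<open>P_bar\<^sub>i\<close> times \<open>F\<^sub>i\<close>
  (lemma \<open>T_weighted_eq_sum_F\<close>). The triangle inequality gives
  \<open>\<parallel>T\<parallel> \<le> \<Sum> u\<^sub>i \<bar>F\<^sub>i\<bar> \<parallel>\<Delta>x\<^sub>i\<parallel>\<close> with \<open>u\<^sub>i = \<bar>P\<^sub>i\<bar> \<bar>P_bar\<^sub>i\<bar>\<close>, and the three bounds are Hoelder's inequality for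
  the weights \<open>u\<close> with the exponent pairs \<open>(\<infinity>, 1)\<close>, \<open>(q, p)\<close> and \<open>(1, \<infinity>)\<close>.

  The unweighted functional is the weighted one at \<open>w\<^sub>i = 1/n\<close>. There \<open>F = G\<close> and
  \<open>u\<^sub>i = i(n - i)/n\<^sup>2\<close>; as \<open>1/p + 1/q = 1\<close>, the factor \<open>1/n\<^sup>2\<close> leaves both Hoelder factors as a single
  \<open>1/n\<^sup>2\<close>.

  For \<open>n = 2\<close> all sums and maxima have one term, so each inequality is an equality
  (lemma \<open>bounds_attained_2\<close>). Sharpness then needs just one instance with \<open>T \<noteq> 0\<close>, and
  \<open>a = x = (0, 1)\<close> in the one-dimensional space \<open>K\<close> is one. It has equal weights,
  so sharpness of the unweighted bounds already implies that of the weighted ones.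
\<close>

section \<open>Hoelder's inequality for weighted finite sums\<close>

lemma conjugate_exponent_gt_1:
  fixes p q :: real
  assumes "p > 1" "1 / p + 1 / q = 1"
  shows "q > 1"
proof -
  have "1 / q = 1 - 1 / p" "1 / p < 1" "1 / p > 0" using assms by (auto simp: field_simps)
  then have "0 < 1 / q" "1 / q < 1" by linarith+
  then show ?thesis by (auto simp: field_simps split: if_splits)
qed

text \<open>
  After division by the norms \<open>s\<close> of \<open>f\<close> and \<open>t\<close> of \<open>g\<close>, Young's inequality bounds each product, and
  the sum of the bounds is \<open>1/q + 1/p = 1\<close>. If one of the norms vanishes, so does every term on the left.
\<close>
lemma weighted_sum_Hoelder:
  fixes u f g :: "'i \<Rightarrow> real"
  assumes "finite I" and p: "p > 1" and pq: "1 / p + 1 / q = 1"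
    and u: "\<And>i. i \<in> I \<Longrightarrow> 0 \<le> u i"
    and f: "\<And>i. i \<in> I \<Longrightarrow> 0 \<le> f i" and g: "\<And>i. i \<in> I \<Longrightarrow> 0 \<le> g i"
  shows "(\<Sum>i\<in>I. u i * f i * g i)
       \<le> (\<Sum>i\<in>I. u i * f i powr q) powr (1 / q) * (\<Sum>i\<in>I. u i * g i powr p) powr (1 / p)"
    (is "_ \<le> ?S powr _ * ?T powr _")
proof -
  have q: "q > 1" using conjugate_exponent_gt_1[OF p pq] .
  have S0: "?S \<ge> 0" and T0: "?T \<ge> 0" using u by (auto intro!: sum_nonneg)
  show ?thesis
  proof (cases "?S = 0 \<or> ?T = 0")
    case True
    have "u i * f i * g i = 0" if "i \<in> I" for i
    proof -
      have "u i * f i powr q = 0 \<or> u i * g i powr p = 0"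
        using True sum_nonneg_eq_0_iff[OF assms(1), of "\<lambda>i. u i * f i powr q"]
          sum_nonneg_eq_0_iff[OF assms(1), of "\<lambda>i. u i * g i powr p"] u that by auto
      then show ?thesis by auto
    qed
    then have "(\<Sum>i\<in>I. u i * f i * g i) = 0" by (intro sum.neutral) blast
    then show ?thesis by simp
  next
    case False
    then have S: "?S > 0" and T: "?T > 0" using S0 T0 by auto
    define s t where "s = ?S powr (1 / q)" and "t = ?T powr (1 / p)"
    have st: "s > 0" "t > 0" "s powr q = ?S" "t powr p = ?T"
      using S T p q by (auto simp: s_def t_def powr_powr)
    have "u i * f i * g i \<le> s * t * (u i * f i powr q / ?S / q + u i * g i powr p / ?T / p)"
      if i: "i \<in> I" for i
    proof -
      have "(g i / t) * (f i / s) \<le> (g i / t) powr p / p + (f i / s) powr q / q"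
        using Youngs_inequality[of p q "g i / t" "f i / s"] p q pq f g i st by auto
      also have "\<dots> = g i powr p / ?T / p + f i powr q / ?S / q"
        using f g i st by (simp add: powr_divide)
      finally have "u i * (g i / t * (f i / s)) \<le> u i * (g i powr p / ?T / p + f i powr q / ?S / q)"
        by (rule mult_left_mono) (rule u[OF i])
      then have "s * t * (u i * (g i / t * (f i / s)))
          \<le> s * t * (u i * (g i powr p / ?T / p + f i powr q / ?S / q))"
        by (rule mult_left_mono) (use st in simp)
      moreover have "s * t * (u i * (g i / t * (f i / s))) = u i * f i * g i"
        using st by (simp add: field_simps)
      ultimately show ?thesis by (simp add: algebra_simps)
    qed
    then have "(\<Sum>i\<in>I. u i * f i * g i)
        \<le> (\<Sum>i\<in>I. s * t * (u i * f i powr q / ?S / q + u i * g i powr p / ?T / p))"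
      by (rule sum_mono)
    also have "\<dots> = s * t * (?S / ?S / q + ?T / ?T / p)"
      by (simp only: sum_distrib_left[symmetric] sum.distrib sum_divide_distrib[symmetric])
    also have "\<dots> = s * t"
      using S T pq by (simp add: add.commute)
    finally show ?thesis by (simp add: s_def t_def)
  qed
qed

section \<open>The functional as a combination of differences\<close>

context normed_space_over
begin

text \<open>
  With these equations the module laws can be used with the operations of \<^typ>\<open>complex\<close> in place of
  those of the ring record, so that coefficients are computed by ordinary complex arithmetic.
\<close>
lemma scalar_simps [simp]:
  "carrier (scalar_field K) = K" "\<one>\<^bsub>scalar_field K\<^esub> = 1" "\<zero>\<^bsub>scalar_field K\<^esub> = 0"
  "b \<oplus>\<^bsub>scalar_field K\<^esub> c = b + c" "b \<otimes>\<^bsub>scalar_field K\<^esub> c = b * c"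
  by (auto simp: scalar_field_def)

lemma K_closed [simp, intro]:
  "complex_of_real r \<in> K"
  "b \<in> K \<Longrightarrow> c \<in> K \<Longrightarrow> b + c \<in> K"
  "b \<in> K \<Longrightarrow> c \<in> K \<Longrightarrow> b - c \<in> K"
  "b \<in> K \<Longrightarrow> c \<in> K \<Longrightarrow> b * c \<in> K"
  "b \<in> K \<Longrightarrow> - b \<in> K"
  "0 \<in> K" "1 \<in> K"
  using real_or_complex by auto

lemma K_sum [intro]: "(\<And>i. i \<in> I \<Longrightarrow> f i \<in> K) \<Longrightarrow> sum f I \<in> K"
  using real_or_complex by auto

lemma smult_in_carrier: "c \<in> K \<Longrightarrow> v \<in> carrier X \<Longrightarrow> c \<odot>\<^bsub>X\<^esub> v \<in> carrier X"
  using smult_closed[of c v] by simp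

lemma one_smult [simp]: "v \<in> carrier X \<Longrightarrow> 1 \<odot>\<^bsub>X\<^esub> v = v"
  using smult_one[of v] by simp

lemma smult_add:
  "b \<in> K \<Longrightarrow> c \<in> K \<Longrightarrow> v \<in> carrier X \<Longrightarrow> b \<odot>\<^bsub>X\<^esub> v \<oplus>\<^bsub>X\<^esub> c \<odot>\<^bsub>X\<^esub> v = (b + c) \<odot>\<^bsub>X\<^esub> v"
  using smult_l_distr[of b c v] by simp

lemma smult_smult:
  "b \<in> K \<Longrightarrow> c \<in> K \<Longrightarrow> v \<in> carrier X \<Longrightarrow> b \<odot>\<^bsub>X\<^esub> (c \<odot>\<^bsub>X\<^esub> v) = (b * c) \<odot>\<^bsub>X\<^esub> v"
  using smult_assoc1[of b c v] by simp

lemma minus_smult: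
  assumes "c \<in> K" "v \<in> carrier X"
  shows "\<ominus>\<^bsub>X\<^esub> (c \<odot>\<^bsub>X\<^esub> v) = (- c) \<odot>\<^bsub>X\<^esub> v"
proof (rule M.minus_equality)
  show "(- c) \<odot>\<^bsub>X\<^esub> v \<oplus>\<^bsub>X\<^esub> c \<odot>\<^bsub>X\<^esub> v = \<zero>\<^bsub>X\<^esub>"
    using assms smult_l_null[of v] by (simp add: smult_add)
qed (use assms in auto)

lemma Delta_eq: "x i \<in> carrier X \<Longrightarrow> Delta X x i = x (i + 1) \<oplus>\<^bsub>X\<^esub> (- 1) \<odot>\<^bsub>X\<^esub> x i"
  using minus_smult[of 1 "x i"] by (simp add: Delta_def M.minus_eq)

lemma Delta_closed: "x \<in> {1..n} \<rightarrow> carrier X \<Longrightarrow> i \<in> {1..n - 1} \<Longrightarrow> Delta X x i \<in> carrier X"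
  unfolding Delta_def by (intro M.minus_closed) (auto simp: Pi_iff)

lemma finsum_smult:
  assumes "finite I" "c \<in> K" "f \<in> I \<rightarrow> carrier X"
  shows "c \<odot>\<^bsub>X\<^esub> (\<Oplus>\<^bsub>X\<^esub>i\<in>I. f i) = (\<Oplus>\<^bsub>X\<^esub>i\<in>I. c \<odot>\<^bsub>X\<^esub> f i)"
  using finsum_smult_ldistr[of I c f] assms by simp

text \<open>
  Abel summation: \<open>d\<^sub>i\<close> is the difference of consecutive partial sums of \<open>d\<close>, and the step from \<open>m\<close>
  to \<open>m + 1\<close> moves the old boundary term into the sum of differences.
\<close>
lemma summation_by_parts:
  assumes "d \<in> {1..Suc m} \<rightarrow> K" and "x \<in> {1..Suc m} \<rightarrow> carrier X"
  shows "(\<Oplus>\<^bsub>X\<^esub>i\<in>{1..Suc m}. d i \<odot>\<^bsub>X\<^esub> x i)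
       = (\<Sum>k=1..Suc m. d k) \<odot>\<^bsub>X\<^esub> x (Suc m)
         \<oplus>\<^bsub>X\<^esub> (\<Oplus>\<^bsub>X\<^esub>i\<in>{1..m}. (- (\<Sum>k=1..i. d k)) \<odot>\<^bsub>X\<^esub> Delta X x i)"
proof -
  define D where "D = (\<lambda>i. \<Sum>k=1..i. d k)"
  have "(\<Oplus>\<^bsub>X\<^esub>i\<in>{1..Suc m}. d i \<odot>\<^bsub>X\<^esub> x i)
      = D (Suc m) \<odot>\<^bsub>X\<^esub> x (Suc m) \<oplus>\<^bsub>X\<^esub> (\<Oplus>\<^bsub>X\<^esub>i\<in>{1..m}. (- D i) \<odot>\<^bsub>X\<^esub> Delta X x i)"
    using assms
  proof (induction m)
    case 0
    then show ?case by (simp add: D_def)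
  next
    case (Suc m)
    let ?s = "\<Oplus>\<^bsub>X\<^esub>i\<in>{1..m}. (- D i) \<odot>\<^bsub>X\<^esub> Delta X x i"
    let ?x = "x (Suc m)" and ?y = "x (Suc (Suc m))"
    have mem [simp]: "?x \<in> carrier X" "?y \<in> carrier X" "d (Suc (Suc m)) \<in> K"
      using Suc.prems by (auto simp: Pi_iff)
    have D [simp]: "D i \<in> K" if "i \<le> Suc (Suc m)" for i
      unfolding D_def using that Suc.prems by (intro K_sum) (auto simp: Pi_iff)
    have Delta [simp]: "Delta X x i \<in> carrier X" if "Suc 0 \<le> i \<and> i \<le> Suc m" for i
      using Delta_closed[OF Suc.prems(2)] that by auto
    have s [simp]: "?s \<in> carrier X"
      by (intro M.finsum_closed) (auto intro!: smult_in_carrier)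
    have dx: "d i \<odot>\<^bsub>X\<^esub> x i \<in> carrier X" if "Suc 0 \<le> i" "i \<le> Suc (Suc m)" for i
      using that Suc.prems by (auto simp: Pi_iff intro!: smult_in_carrier)
    have "(\<Oplus>\<^bsub>X\<^esub>i\<in>{1..Suc (Suc m)}. d i \<odot>\<^bsub>X\<^esub> x i)
        = d (Suc (Suc m)) \<odot>\<^bsub>X\<^esub> ?y \<oplus>\<^bsub>X\<^esub> (\<Oplus>\<^bsub>X\<^esub>i\<in>{1..Suc m}. d i \<odot>\<^bsub>X\<^esub> x i)"
      by (subst atLeastAtMostSuc_conv, simp) (subst M.finsum_insert, use dx in auto)
    also have "(\<Oplus>\<^bsub>X\<^esub>i\<in>{1..Suc m}. d i \<odot>\<^bsub>X\<^esub> x i) = D (Suc m) \<odot>\<^bsub>X\<^esub> ?x \<oplus>\<^bsub>X\<^esub> ?s"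
      using Suc by (auto simp: Pi_iff)
    also have "d (Suc (Suc m)) \<odot>\<^bsub>X\<^esub> ?y
        = D (Suc (Suc m)) \<odot>\<^bsub>X\<^esub> ?y \<oplus>\<^bsub>X\<^esub> (- D (Suc m)) \<odot>\<^bsub>X\<^esub> ?y"
    proof -
      have "d (Suc (Suc m)) = D (Suc (Suc m)) + (- D (Suc m))"
        by (simp add: D_def)
      then show ?thesis
        using smult_add[of "D (Suc (Suc m))" "- D (Suc m)" ?y] by simp
    qed
    also have "\<dots> \<oplus>\<^bsub>X\<^esub> (D (Suc m) \<odot>\<^bsub>X\<^esub> ?x \<oplus>\<^bsub>X\<^esub> ?s)
        = D (Suc (Suc m)) \<odot>\<^bsub>X\<^esub> ?y
          \<oplus>\<^bsub>X\<^esub> (((- D (Suc m)) \<odot>\<^bsub>X\<^esub> ?y \<oplus>\<^bsub>X\<^esub> D (Suc m) \<odot>\<^bsub>X\<^esub> ?x) \<oplus>\<^bsub>X\<^esub> ?s)"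
      by (simp add: M.a_assoc smult_in_carrier)
    also have "(- D (Suc m)) \<odot>\<^bsub>X\<^esub> ?y \<oplus>\<^bsub>X\<^esub> D (Suc m) \<odot>\<^bsub>X\<^esub> ?x
        = (- D (Suc m)) \<odot>\<^bsub>X\<^esub> Delta X x (Suc m)"
      using smult_r_distr[of "- D (Suc m)" ?y "(- 1) \<odot>\<^bsub>X\<^esub> ?x"]
      by (simp add: Delta_eq smult_smult smult_in_carrier)
    also have "(- D (Suc m)) \<odot>\<^bsub>X\<^esub> Delta X x (Suc m) \<oplus>\<^bsub>X\<^esub> ?s
        = (\<Oplus>\<^bsub>X\<^esub>i\<in>{1..Suc m}. (- D i) \<odot>\<^bsub>X\<^esub> Delta X x i)"
      by (subst atLeastAtMostSuc_conv, simp)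
        (subst M.finsum_insert, auto intro!: smult_in_carrier)
    finally show ?case .
  qed
  then show ?thesis by (simp only: D_def)
qed

text \<open>
  The boundary term of the summation by parts vanishes because
  \<open>\<Sum> (P\<^sub>n w\<^sub>i a\<^sub>i - A\<^sub>n w\<^sub>i) = P\<^sub>n A\<^sub>n - A\<^sub>n P\<^sub>n = 0\<close>.
\<close>
lemma T_weighted_eq_sum_Delta:
  assumes n: "n \<ge> 1" and a: "a \<in> {1..n} \<rightarrow> K" and x: "x \<in> {1..n} \<rightarrow> carrier X"
  shows "T_weighted X n w a x
       = (\<Oplus>\<^bsub>X\<^esub>i\<in>{1..n-1}. (of_real (P w i) * A w a n - of_real (P w n) * A w a i) \<odot>\<^bsub>X\<^esub> Delta X x i)"
proof -
  let ?d = "\<lambda>i. of_real (P w n) * (of_real (w i) * a i) - A w a n * of_real (w i)"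
  have A: "A w a i \<in> K" if "i \<le> n" for i
    unfolding A_def using a that by (intro K_sum) (auto simp: Pi_iff)
  have aK: "a i \<in> K" and xX: "x i \<in> carrier X" if "i \<in> {1..n}" for i
    using that a x by (auto simp: Pi_iff)
  have dK: "?d \<in> {1..n} \<rightarrow> K" using aK A by auto
  have D: "(\<Sum>k=1..i. ?d k) = of_real (P w n) * A w a i - A w a n * of_real (P w i)" for i
    by (simp add: sum_subtractf sum_distrib_left P_def A_def)
  let ?S = "\<Oplus>\<^bsub>X\<^esub>i\<in>{1..n}. of_real (w i) \<odot>\<^bsub>X\<^esub> x i"
  have S: "?S \<in> carrier X" using xX by (intro M.finsum_closed) auto
  have "T_weighted X n w a x
      = of_real (P w n) \<odot>\<^bsub>X\<^esub> (\<Oplus>\<^bsub>X\<^esub>i\<in>{1..n}. (of_real (w i) * a i) \<odot>\<^bsub>X\<^esub> x i) \<oplus>\<^bsub>X\<^esub> (- A w a n) \<odot>\<^bsub>X\<^esub> ?S"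
    using minus_smult[OF A[OF order_refl] S]
    by (simp only: T_weighted_def A_def[symmetric] M.minus_eq)
  also have "\<dots> = (\<Oplus>\<^bsub>X\<^esub>i\<in>{1..n}. of_real (P w n) \<odot>\<^bsub>X\<^esub> ((of_real (w i) * a i) \<odot>\<^bsub>X\<^esub> x i))
      \<oplus>\<^bsub>X\<^esub> (\<Oplus>\<^bsub>X\<^esub>i\<in>{1..n}. (- A w a n) \<odot>\<^bsub>X\<^esub> (of_real (w i) \<odot>\<^bsub>X\<^esub> x i))"
    using aK xX A by (subst (1 2) finsum_smult) auto
  also have "\<dots> = (\<Oplus>\<^bsub>X\<^esub>i\<in>{1..n}. of_real (P w n) \<odot>\<^bsub>X\<^esub> ((of_real (w i) * a i) \<odot>\<^bsub>X\<^esub> x i)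
      \<oplus>\<^bsub>X\<^esub> (- A w a n) \<odot>\<^bsub>X\<^esub> (of_real (w i) \<odot>\<^bsub>X\<^esub> x i))"
    using aK xX A by (intro M.finsum_addf[symmetric]) auto
  also have "\<dots> = (\<Oplus>\<^bsub>X\<^esub>i\<in>{1..n}. ?d i \<odot>\<^bsub>X\<^esub> x i)"
    using aK xX A by (intro M.finsum_cong) (auto simp: simp_implies_def smult_smult smult_add)
  also have "\<dots> = (\<Sum>k=1..n. ?d k) \<odot>\<^bsub>X\<^esub> x n
      \<oplus>\<^bsub>X\<^esub> (\<Oplus>\<^bsub>X\<^esub>i\<in>{1..n-1}. (- (\<Sum>k=1..i. ?d k)) \<odot>\<^bsub>X\<^esub> Delta X x i)"
    using summation_by_parts[of ?d "n - 1" x] dK x n by simp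
  also have "(\<Sum>k=1..n. ?d k) \<odot>\<^bsub>X\<^esub> x n = \<zero>\<^bsub>X\<^esub>"
    using smult_l_null[of "x n"] xX n unfolding D by simp
  also have "\<zero>\<^bsub>X\<^esub> \<oplus>\<^bsub>X\<^esub> (\<Oplus>\<^bsub>X\<^esub>i\<in>{1..n-1}. (- (\<Sum>k=1..i. ?d k)) \<odot>\<^bsub>X\<^esub> Delta X x i)
      = (\<Oplus>\<^bsub>X\<^esub>i\<in>{1..n-1}. (- (\<Sum>k=1..i. ?d k)) \<odot>\<^bsub>X\<^esub> Delta X x i)"
    using A Delta_closed[OF x] unfolding D by (intro M.l_zero M.finsum_closed) auto
  finally show ?thesis unfolding D by (simp add: mult.commute)
qed

lemma nrm_finsum_le:
  assumes "finite I" "f \<in> I \<rightarrow> carrier X"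
  shows "nrm (\<Oplus>\<^bsub>X\<^esub>i\<in>I. f i) \<le> (\<Sum>i\<in>I. nrm (f i))"
  using assms
proof (induction I)
  case empty
  then show ?case using nrm_eq_0_iff[of "\<zero>\<^bsub>X\<^esub>"] by simp
next
  case (insert j I)
  then have "nrm (\<Oplus>\<^bsub>X\<^esub>i\<in>insert j I. f i) \<le> nrm (f j) + nrm (\<Oplus>\<^bsub>X\<^esub>i\<in>I. f i)"
    by (subst M.finsum_insert) (auto intro!: nrm_triangle M.finsum_closed)
  with insert show ?case by auto
qed

text \<open>
  The terms \<open>P\<^sub>i A\<^sub>i\<close> cancel in \<open>P\<^sub>i (A\<^sub>n - A\<^sub>i) - (P\<^sub>n - P\<^sub>i) A\<^sub>i\<close>, which is what clearing the
  denominators of \<open>F\<^sub>i\<close> leaves. Nondegeneracy makes these denominators nonzero.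
\<close>
lemma P_P_bar_F:
  assumes "nondegenerate n w" "i \<in> {1..n-1}"
  shows "of_real (P w i) * of_real (P_bar n w i) * F n w a i
       = of_real (P w i) * A w a n - of_real (P w n) * A w a i"
proof -
  have "complex_of_real (P w i) \<noteq> 0" "complex_of_real (P_bar n w i) \<noteq> 0"
    using assms by (auto simp: nondegenerate_def)
  then show ?thesis
    by (simp add: F_def A_bar_def diff_divide_eq_iff divide_diff_eq_iff)
      (simp add: P_bar_def algebra_simps)
qed

lemma T_weighted_eq_sum_F:
  assumes "n \<ge> 1" "nondegenerate n w" "a \<in> {1..n} \<rightarrow> K" "x \<in> {1..n} \<rightarrow> carrier X"
  shows "T_weighted X n w a x
       = (\<Oplus>\<^bsub>X\<^esub>i\<in>{1..n-1}. (of_real (P w i) * of_real (P_bar n w i) * F n w a i) \<odot>\<^bsub>X\<^esub> Delta X x i)"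
    "\<And>i. i \<in> {1..n-1} \<Longrightarrow> of_real (P w i) * of_real (P_bar n w i) * F n w a i \<in> K"
proof -
  show K: "of_real (P w i) * of_real (P_bar n w i) * F n w a i \<in> K" if "i \<in> {1..n-1}" for i
  proof -
    have "A w a j \<in> K" if "j \<le> n" for j
      unfolding A_def using assms(3) that by (intro K_sum) (auto simp: Pi_iff)
    then show ?thesis using that unfolding P_P_bar_F[OF assms(2) that] by auto
  qed
  show "T_weighted X n w a x
       = (\<Oplus>\<^bsub>X\<^esub>i\<in>{1..n-1}. (of_real (P w i) * of_real (P_bar n w i) * F n w a i) \<odot>\<^bsub>X\<^esub> Delta X x i)"
    unfolding T_weighted_eq_sum_Delta[OF assms(1,3,4)]
    by (rule M.finsum_cong)
      (use assms K Delta_closed[OF assms(4)] in \<open>auto simp: simp_implies_def P_P_bar_F\<close>)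
qed

lemma nrm_smult_Delta:
  assumes "n \<ge> 1" "nondegenerate n w" "a \<in> {1..n} \<rightarrow> K" "x \<in> {1..n} \<rightarrow> carrier X" "i \<in> {1..n-1}"
  shows "nrm ((of_real (P w i) * of_real (P_bar n w i) * F n w a i) \<odot>\<^bsub>X\<^esub> Delta X x i)
       = \<bar>P w i\<bar> * \<bar>P_bar n w i\<bar> * cmod (F n w a i) * nrm (Delta X x i)"
  using nrm_smult[OF T_weighted_eq_sum_F(2)[OF assms] Delta_closed[OF assms(4,5)]]
  by (simp add: norm_mult)

lemma nrm_T_weighted_le:
  assumes "n \<ge> 1" "nondegenerate n w" "a \<in> {1..n} \<rightarrow> K" "x \<in> {1..n} \<rightarrow> carrier X"
  shows "nrm (T_weighted X n w a x)
       \<le> (\<Sum>i=1..n-1. \<bar>P w i\<bar> * \<bar>P_bar n w i\<bar> * cmod (F n w a i) * nrm (Delta X x i))"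
proof -
  have "nrm (T_weighted X n w a x) \<le>
    (\<Sum>i=1..n-1. nrm ((of_real (P w i) * of_real (P_bar n w i) * F n w a i) \<odot>\<^bsub>X\<^esub> Delta X x i))"
    unfolding T_weighted_eq_sum_F(1)[OF assms]
    using T_weighted_eq_sum_F(2)[OF assms] Delta_closed[OF assms(4)]
    by (intro nrm_finsum_le) auto
  also have "\<dots> = (\<Sum>i=1..n-1. \<bar>P w i\<bar> * \<bar>P_bar n w i\<bar> * cmod (F n w a i) * nrm (Delta X x i))"
    by (intro sum.cong refl nrm_smult_Delta[OF assms])
  finally show ?thesis .
qed

lemma T_weighted_bounds:
  assumes "n \<ge> 1" "nondegenerate n w" "a \<in> {1..n} \<rightarrow> K" "x \<in> {1..n} \<rightarrow> carrier X"
  shows "nrm (T_weighted X n w a x) \<le> weighted_max_sum X nrm n w a x"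
    and "p > 1 \<Longrightarrow> 1 / p + 1 / q = 1 \<Longrightarrow>
      nrm (T_weighted X n w a x) \<le> weighted_Hoelder p q X nrm n w a x"
    and "nrm (T_weighted X n w a x) \<le> weighted_sum_max X nrm n w a x"
proof -
  note T = nrm_T_weighted_le[OF assms]
  have D: "nrm (Delta X x i) \<ge> 0" if "i \<in> {1..n-1}" for i
    using nrm_nonneg Delta_closed[OF assms(4)] that by auto
  show "nrm (T_weighted X n w a x) \<le> weighted_max_sum X nrm n w a x"
  proof (rule order_trans[OF T])
    show "(\<Sum>i=1..n-1. \<bar>P w i\<bar> * \<bar>P_bar n w i\<bar> * cmod (F n w a i) * nrm (Delta X x i))
        \<le> weighted_max_sum X nrm n w a x"
      unfolding weighted_max_sum_def sum_distrib_left
    proof (rule sum_mono)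
      fix i assume i: "i \<in> {1..n-1}"
      have "cmod (F n w a i) \<le> (MAX i\<in>{1..n-1}. cmod (F n w a i))"
        using i by (intro Max_ge) auto
      then have "cmod (F n w a i) * (\<bar>P w i\<bar> * \<bar>P_bar n w i\<bar> * nrm (Delta X x i))
          \<le> (MAX i\<in>{1..n-1}. cmod (F n w a i)) * (\<bar>P w i\<bar> * \<bar>P_bar n w i\<bar> * nrm (Delta X x i))"
        using D[OF i] by (intro mult_right_mono) auto
      then show "\<bar>P w i\<bar> * \<bar>P_bar n w i\<bar> * cmod (F n w a i) * nrm (Delta X x i)
          \<le> (MAX i\<in>{1..n-1}. cmod (F n w a i)) * (\<bar>P w i\<bar> * \<bar>P_bar n w i\<bar> * nrm (Delta X x i))"
        by (simp add: mult_ac)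
    qed
  qed
  show "nrm (T_weighted X n w a x) \<le> weighted_Hoelder p q X nrm n w a x"
    if "p > 1" "1 / p + 1 / q = 1"
    unfolding weighted_Hoelder_def
    by (rule order_trans[OF T weighted_sum_Hoelder]) (use that D in auto)
  show "nrm (T_weighted X n w a x) \<le> weighted_sum_max X nrm n w a x"
    unfolding weighted_sum_max_def sum_distrib_right
    by (rule order_trans[OF T], intro sum_mono mult_left_mono Max_ge) auto
qed

text \<open>
  The triangle inequality loses nothing on a single summand.
\<close>
lemma nrm_T_weighted_2:
  assumes "nondegenerate 2 w" "a \<in> {1..2} \<rightarrow> K" "x \<in> {1..2} \<rightarrow> carrier X"
  shows "nrm (T_weighted X 2 w a x)
       = \<bar>P w 1\<bar> * \<bar>P_bar 2 w 1\<bar> * cmod (F 2 w a 1) * nrm (Delta X x 1)"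
proof -
  have "T_weighted X 2 w a x
      = (of_real (P w 1) * of_real (P_bar 2 w 1) * F 2 w a 1) \<odot>\<^bsub>X\<^esub> Delta X x 1"
    using T_weighted_eq_sum_F[of 2, OF _ assms] Delta_closed[OF assms(3)] by simp
  then show ?thesis using nrm_smult_Delta[of 2, OF _ assms, of 1] by simp
qed

end

section \<open>Equal weights\<close>

lemma P_equal_weights: "P (\<lambda>_. 1 / real n) i = real i / real n"
  by (simp add: P_def)

lemma P_bar_equal_weights:
  "n \<ge> 1 \<Longrightarrow> i \<le> n \<Longrightarrow> P_bar n (\<lambda>_. 1 / real n) i = real (n - i) / real n"
  by (simp add: P_bar_def P_equal_weights of_nat_diff diff_divide_distrib)

lemma nondegenerate_equal_weights: "nondegenerate n (\<lambda>_. 1 / real n)"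
  unfolding nondegenerate_def
proof
  fix i assume "i \<in> {1..n-1}"
  then have "1 \<le> i" "i < n" by auto
  then show "P (\<lambda>_. 1 / real n) i \<noteq> 0 \<and> P_bar n (\<lambda>_. 1 / real n) i \<noteq> 0"
    by (simp add: P_equal_weights P_bar_equal_weights)
qed

lemma F_equal_weights:
  assumes "i \<in> {1..n-1}"
  shows "F n (\<lambda>_. 1 / real n) a i = G n a i"
proof -
  have A: "A (\<lambda>_. 1 / real n) a i = (\<Sum>k=1..i. a k) / of_nat n" for i
    by (simp add: A_def sum_divide_distrib)
  have "(\<Sum>k=1..n. a k) - (\<Sum>k=1..i. a k) = (\<Sum>k=i+1..n. a k)"
    using assms sum.ub_add_nat[of 1 i a "n - i"] by (auto simp: algebra_simps)
  then have Ab: "A_bar n (\<lambda>_. 1 / real n) a i = (\<Sum>k=i+1..n. a k) / of_nat n"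
    by (simp add: A_bar_def A diff_divide_distrib[symmetric])
  have "1 \<le> i" "i < n" using assms by auto
  then show ?thesis
    by (simp add: F_def G_def Ab A P_equal_weights P_bar_equal_weights)
qed

context normed_space_over
begin

lemma T_unweighted_eq:
  assumes n: "n \<ge> 1" and a: "a \<in> {1..n} \<rightarrow> K" and x: "x \<in> {1..n} \<rightarrow> carrier X"
  shows "T_unweighted X n a x = T_weighted X n (\<lambda>_. 1 / real n) a x"
proof -
  have N: "1 / of_nat n \<in> K" using K_closed(1)[of "1 / real n"] by simp
  have aK: "a i \<in> K" and xX: "x i \<in> carrier X" if "i \<in> {1..n}" for i
    using that a x by (auto simp: Pi_iff)
  have 1: "(1 / of_nat n) \<odot>\<^bsub>X\<^esub> (\<Oplus>\<^bsub>X\<^esub>i\<in>{1..n}. a i \<odot>\<^bsub>X\<^esub> x i)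
      = (\<Oplus>\<^bsub>X\<^esub>i\<in>{1..n}. (1 / of_nat n * a i) \<odot>\<^bsub>X\<^esub> x i)"
    using aK xX N K_closed(4)[OF N]
    by (subst finsum_smult) (auto intro!: M.finsum_cong simp: smult_smult simp_implies_def)
  have 2: "(1 / of_nat n) \<odot>\<^bsub>X\<^esub> (\<Oplus>\<^bsub>X\<^esub>i\<in>{1..n}. x i) = (\<Oplus>\<^bsub>X\<^esub>i\<in>{1..n}. (1 / of_nat n) \<odot>\<^bsub>X\<^esub> x i)"
    using x N by (intro finsum_smult) auto
  have 3: "(\<Oplus>\<^bsub>X\<^esub>i\<in>{1..n}. (1 / of_nat n * a i) \<odot>\<^bsub>X\<^esub> x i) \<in> carrier X"
    using aK xX K_closed(4)[OF N] by (intro M.finsum_closed) auto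
  show ?thesis
    unfolding T_unweighted_def T_weighted_def 1 2
    using n 3 by (simp add: P_equal_weights sum_divide_distrib)
qed

end

text \<open>
  All three bounds contain the weights only through sums of this form, so this is where the factor
  \<open>1/n\<^sup>2\<close> of the unweighted bounds comes from.
\<close>
lemma sum_equal_weights:
  "(\<Sum>i=1..n-1. \<bar>P (\<lambda>_. 1 / real n) i\<bar> * \<bar>P_bar n (\<lambda>_. 1 / real n) i\<bar> * h i)
   = 1 / (real n)\<^sup>2 * (\<Sum>i=1..n-1. real i * real (n - i) * h i)"
  unfolding sum_distrib_left
  by (rule sum.cong) (auto simp: P_equal_weights P_bar_equal_weights power2_eq_square)

lemma weighted_max_sum_equal_weights:
  "weighted_max_sum X nrm n (\<lambda>_. 1 / real n) a x = unweighted_max_sum X nrm n a x"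
  unfolding weighted_max_sum_def unweighted_max_sum_def sum_equal_weights
  by (simp add: F_equal_weights cong: image_cong_simp)

text \<open>
  The factor \<open>c = 1/n\<^sup>2\<close> appears under both roots, with total exponent \<open>1/q + 1/p = 1\<close>.
\<close>
lemma weighted_Hoelder_equal_weights:
  assumes "n \<ge> 1" and "1 / p + 1 / q = 1"
  shows "weighted_Hoelder p q X nrm n (\<lambda>_. 1 / real n) a x = unweighted_Hoelder p q X nrm n a x"
proof -
  define c where "c = 1 / (real n)\<^sup>2"
  have c: "c > 0" using assms(1) by (simp add: c_def)
  have "c powr (1 / q) * c powr (1 / p) = c"
    using assms(2) c by (simp add: powr_add[symmetric] add.commute)
  then have "(c * s) powr (1 / q) * (c * t) powr (1 / p) = c * s powr (1 / q) * t powr (1 / p)"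
    if "s \<ge> 0" "t \<ge> 0" for s t
    using that c by (simp add: powr_mult)
  then show ?thesis
    unfolding weighted_Hoelder_def unweighted_Hoelder_def sum_equal_weights c_def[symmetric]
    by (simp add: F_equal_weights sum_nonneg cong: sum.cong_simp)
qed

lemma weighted_sum_max_equal_weights:
  "weighted_sum_max X nrm n (\<lambda>_. 1 / real n) a x = unweighted_sum_max X nrm n a x"
  unfolding weighted_sum_max_def unweighted_sum_max_def sum_equal_weights
  by (simp add: F_equal_weights cong: sum.cong_simp)

section \<open>Sharpness\<close>

text \<open>
  The one-dimensional space \<open>K\<close>, embedded in the type of sequences as the constant ones. The value at
  \<open>0\<close> recovers the scalar, so its modulus is a norm.
\<close>
definition scalar_line :: "complex set \<Rightarrow> (complex, nat \<Rightarrow> complex) module" where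
  "scalar_line K = \<lparr>carrier = (\<lambda>c _. c) ` K,
     mult = (\<lambda>f g i. f i * g i), one = (\<lambda>_. 1), zero = (\<lambda>_. 0), add = (\<lambda>f g i. f i + g i),
     smult = (\<lambda>c f i. c * f i)\<rparr>"

lemma cring_scalar_field:
  assumes "K = \<real> \<or> K = UNIV"
  shows "cring (scalar_field K)"
proof (rule cringI)
  show "abelian_group (scalar_field K)"
  proof (rule abelian_groupI)
    fix x assume "x \<in> carrier (scalar_field K)"
    then show "\<exists>y\<in>carrier (scalar_field K). y \<oplus>\<^bsub>scalar_field K\<^esub> x = \<zero>\<^bsub>scalar_field K\<^esub>"
      using assms by (intro bexI[of _ "- x"]) (auto simp: scalar_field_def)
  qed (use assms in \<open>auto simp: scalar_field_def\<close>)
  show "Group.comm_monoid (scalar_field K)"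
    by (rule comm_monoidI) (use assms in \<open>auto simp: scalar_field_def\<close>)
qed (auto simp: scalar_field_def algebra_simps)

lemma normed_space_scalar_line:
  assumes K: "K = \<real> \<or> K = UNIV"
  shows "normed_space_over K (scalar_line K) (\<lambda>f. cmod (f 0))"
proof -
  have closed: "0 \<in> K" "\<And>b c. b \<in> K \<Longrightarrow> c \<in> K \<Longrightarrow> b + c \<in> K"
    "\<And>b c. b \<in> K \<Longrightarrow> c \<in> K \<Longrightarrow> b * c \<in> K" "\<And>b. b \<in> K \<Longrightarrow> - b \<in> K"
    using K by auto
  have "abelian_group (scalar_line K)"
  proof (rule abelian_groupI)
    fix x assume "x \<in> carrier (scalar_line K)"
    then show "\<exists>y\<in>carrier (scalar_line K). y \<oplus>\<^bsub>scalar_line K\<^esub> x = \<zero>\<^bsub>scalar_line K\<^esub>"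
      using closed by (intro bexI[of _ "\<lambda>i. - x i"]) (auto simp: scalar_line_def)
  qed (use closed in \<open>auto simp: scalar_line_def fun_eq_iff\<close>)
  then have "module (scalar_field K) (scalar_line K)"
    using closed
    by (intro moduleI cring_scalar_field[OF K])
      (auto simp: scalar_field_def scalar_line_def fun_eq_iff algebra_simps)
  then show ?thesis
    by (rule normed_space_over.intro, unfold_locales)
      (use K in \<open>auto simp: scalar_line_def fun_eq_iff norm_mult norm_triangle_ineq\<close>)
qed

text \<open>
  If the bound is always attained for \<open>n = 2\<close>, any admissible \<open>C\<close> satisfies \<open>\<parallel>T\<parallel> \<le> C \<parallel>T\<parallel>\<close> there, and it
  remains to find data with \<open>T \<noteq> 0\<close>. In the scalar line, \<open>a = x = (0, 1)\<close> has \<open>G\<^sub>1 = 1\<close> and \<open>\<Delta>x\<^sub>1 = 1\<close>.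
\<close>
lemma sharp_unweightedI:
  assumes K: "K = \<real> \<or> K = UNIV"
    and eq: "\<And>X nrm a x. normed_space_over K X nrm \<Longrightarrow> a \<in> {1..2} \<rightarrow> K \<Longrightarrow> x \<in> {1..2} \<rightarrow> carrier X
      \<Longrightarrow> R X nrm 2 a x = nrm (T_unweighted X 2 a x)"
  shows "sharp_unweighted K R"
  unfolding sharp_unweighted_def
proof (intro allI impI)
  fix C :: real
  assume "C > 0" and C: "\<forall>n\<ge>2. \<forall>X nrm. normed_space_over K X nrm \<longrightarrow>
    (\<forall>a\<in>{1..n} \<rightarrow> K. \<forall>x\<in>{1..n} \<rightarrow> carrier X.
       nrm (T_unweighted X n a x) \<le> C * R X nrm n a x)"
  let ?X = "scalar_line K" and ?nrm = "\<lambda>f::nat \<Rightarrow> complex. cmod (f 0)"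
  let ?a = "\<lambda>i::nat. if i = 1 then 0 else 1 :: complex"
  let ?x = "\<lambda>i (_::nat). ?a i"
  interpret normed_space_over K ?X ?nrm by (rule normed_space_scalar_line[OF K])
  have a: "?a \<in> {1..2} \<rightarrow> K" by auto
  have x: "?x \<in> {1..2} \<rightarrow> carrier ?X" by (auto simp: scalar_line_def)
  have "Delta ?X ?x 1 = (\<lambda>_. 1)"
    using Delta_eq[of ?x 1] x by (simp add: Pi_iff) (simp add: scalar_line_def)
  moreover have "G 2 ?a 1 = 1"
    by (simp add: G_def numeral_2_eq_2)
  ultimately have "?nrm (T_unweighted ?X 2 ?a ?x) > 0"
    using nondegenerate_equal_weights[of 2, unfolded nondegenerate_def]
    unfolding T_unweighted_eq[OF one_le_numeral a x, unfolded of_nat_numeral]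
      nrm_T_weighted_2[OF nondegenerate_equal_weights[of 2, unfolded of_nat_numeral] a x]
    by (simp add: F_equal_weights[of 1 2, simplified])
  moreover have "?nrm (T_unweighted ?X 2 ?a ?x) \<le> C * R ?X ?nrm 2 ?a ?x"
    using C normed_space_over_axioms a x by blast
  ultimately show "C \<ge> 1"
    using eq[OF normed_space_over_axioms a x] by simp
qed

text \<open>
  A constant that is admissible for all weights is admissible for equal weights.
\<close>
lemma sharp_weighted_of_unweighted:
  assumes "\<And>n X nrm a x. n \<ge> 1 \<Longrightarrow> R X nrm n (\<lambda>_. 1 / real n) a x = R' X nrm n a x"
    and "sharp_unweighted K R'"
  shows "sharp_weighted K R"
  unfolding sharp_weighted_def
proof (intro allI impI)
  fix C :: real
  assume "C > 0" and C: "\<forall>n\<ge>2. \<forall>X nrm. normed_space_over K X nrm \<longrightarrow>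
    (\<forall>w. nondegenerate n w \<longrightarrow> (\<forall>a\<in>{1..n} \<rightarrow> K. \<forall>x\<in>{1..n} \<rightarrow> carrier X.
       nrm (T_weighted X n w a x) \<le> C * R X nrm n w a x))"
  have "nrm (T_unweighted X n a x) \<le> C * R' X nrm n a x"
    if n: "n \<ge> 2" and X: "normed_space_over K X nrm"
      and a: "a \<in> {1..n} \<rightarrow> K" and x: "x \<in> {1..n} \<rightarrow> carrier X" for n X nrm a x
  proof -
    have "nrm (T_weighted X n (\<lambda>_. 1 / real n) a x) \<le> C * R X nrm n (\<lambda>_. 1 / real n) a x"
      using C n X a x nondegenerate_equal_weights by blast
    then show ?thesis
      using n assms(1)[of n X nrm a x] normed_space_over.T_unweighted_eq[OF X _ a x] by simp
  qed
  then show "C \<ge> 1"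
    using assms(2) \<open>C > 0\<close> unfolding sharp_unweighted_def by blast
qed

text \<open>
  With a single index, the maxima are the values themselves and Hoelder's inequality is an identity:
  the exponents cancel on each factor, and the roots \<open>u\<^sup>1\<^sup>/\<^sup>q\<close> and \<open>u\<^sup>1\<^sup>/\<^sup>p\<close> of the weight multiply to \<open>u\<close>.
\<close>
lemma (in normed_space_over) bounds_attained_2:
  assumes "nondegenerate 2 w" "a \<in> {1..2} \<rightarrow> K" "x \<in> {1..2} \<rightarrow> carrier X"
  shows "weighted_max_sum X nrm 2 w a x = nrm (T_weighted X 2 w a x)"
    and "p > 1 \<Longrightarrow> 1 / p + 1 / q = 1 \<Longrightarrow>
      weighted_Hoelder p q X nrm 2 w a x = nrm (T_weighted X 2 w a x)"
    and "weighted_sum_max X nrm 2 w a x = nrm (T_weighted X 2 w a x)"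
proof -
  have D: "nrm (Delta X x 1) \<ge> 0"
    using nrm_nonneg Delta_closed[OF assms(3), of 1] by simp
  note T = nrm_T_weighted_2[OF assms]
  show "weighted_max_sum X nrm 2 w a x = nrm (T_weighted X 2 w a x)"
    and "weighted_sum_max X nrm 2 w a x = nrm (T_weighted X 2 w a x)"
    unfolding T weighted_max_sum_def weighted_sum_max_def by simp_all
  show "weighted_Hoelder p q X nrm 2 w a x = nrm (T_weighted X 2 w a x)"
    if p: "p > 1" and pq: "1 / p + 1 / q = 1"
  proof -
    have q: "q > 1" using conjugate_exponent_gt_1[OF p pq] .
    define u where "u = \<bar>P w 1\<bar> * \<bar>P_bar 2 w 1\<bar>"
    have u: "u > 0" using assms(1) by (auto simp: u_def nondegenerate_def)
    have "u powr (1 / q) * u powr (1 / p) = u"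
      using pq u by (simp add: powr_add[symmetric] add.commute)
    then have "(u * f powr q) powr (1 / q) * (u * g powr p) powr (1 / p) = u * f * g"
      if "f \<ge> 0" "g \<ge> 0" for f g
      using that u p q by (simp add: powr_mult powr_powr)
    then show ?thesis
      unfolding T weighted_Hoelder_def using D by (simp add: u_def)
  qed
qed

lemma
  assumes "K = \<real> \<or> K = UNIV"
  shows sharp_unweighted_max_sum: "sharp_unweighted K unweighted_max_sum"
    and sharp_unweighted_Hoelder:
      "p > 1 \<Longrightarrow> 1 / p + 1 / q = 1 \<Longrightarrow> sharp_unweighted K (unweighted_Hoelder p q)"
    and sharp_unweighted_sum_max: "sharp_unweighted K unweighted_sum_max"
proof -
  note [simp] = normed_space_over.T_unweighted_eq[where n = 2]
    weighted_max_sum_equal_weights[where n = 2, symmetric]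
    weighted_Hoelder_equal_weights[where n = 2, symmetric]
    weighted_sum_max_equal_weights[where n = 2, symmetric]
  note bounds = normed_space_over.bounds_attained_2[OF _ nondegenerate_equal_weights]
  show "sharp_unweighted K unweighted_max_sum"
    by (rule sharp_unweightedI[OF assms]) (use bounds(1) in simp)
  show "sharp_unweighted K unweighted_sum_max"
    by (rule sharp_unweightedI[OF assms]) (use bounds(3) in simp)
  show "sharp_unweighted K (unweighted_Hoelder p q)" if "p > 1" "1 / p + 1 / q = 1"
    by (rule sharp_unweightedI[OF assms]) (use that bounds(2)[OF _ _ _ that] in simp)
qed

theorem theorem6:
  fixes K :: "complex set" and X :: "(complex, 'v) module" and nrm :: "'v \<Rightarrow> real"
    and n :: nat and a :: "nat \<Rightarrow> complex" and x :: "nat \<Rightarrow> 'v"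
  assumes "n \<ge> 2"
    and "K = \<real> \<or> K = UNIV"
    and "normed_space_over K X nrm"
    and "a \<in> {1..n} \<rightarrow> K"
    and "x \<in> {1..n} \<rightarrow> carrier X"
  shows
    "(\<forall>w. nondegenerate n w \<longrightarrow>
        nrm (T_weighted X n w a x) \<le> weighted_max_sum X nrm n w a x \<and>
        (\<forall>p q. p > 1 \<and> 1 / p + 1 / q = 1 \<longrightarrow>
           nrm (T_weighted X n w a x) \<le> weighted_Hoelder p q X nrm n w a x) \<and>
        nrm (T_weighted X n w a x) \<le> weighted_sum_max X nrm n w a x) \<and>
     nrm (T_unweighted X n a x) \<le> unweighted_max_sum X nrm n a x \<and>
     (\<forall>p q. p > 1 \<and> 1 / p + 1 / q = 1 \<longrightarrow>
        nrm (T_unweighted X n a x) \<le> unweighted_Hoelder p q X nrm n a x) \<and>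
     nrm (T_unweighted X n a x) \<le> unweighted_sum_max X nrm n a x \<and>
     sharp_weighted K weighted_max_sum \<and>
     (\<forall>p q. p > 1 \<and> 1 / p + 1 / q = 1 \<longrightarrow> sharp_weighted K (weighted_Hoelder p q)) \<and>
     sharp_weighted K weighted_sum_max \<and>
     sharp_unweighted K unweighted_max_sum \<and>
     (\<forall>p q. p > 1 \<and> 1 / p + 1 / q = 1 \<longrightarrow> sharp_unweighted K (unweighted_Hoelder p q)) \<and>
     sharp_unweighted K unweighted_sum_max"
proof -
  interpret normed_space_over K X nrm by fact
  have n: "n \<ge> 1" using assms(1) by simp
  note K = assms(2) and bounds = T_weighted_bounds[OF n _ assms(4,5)]
  note equal_weights = bounds[OF nondegenerate_equal_weights, folded T_unweighted_eq[OF n assms(4,5)]]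
  have "nrm (T_unweighted X n a x) \<le> unweighted_max_sum X nrm n a x"
    "nrm (T_unweighted X n a x) \<le> unweighted_sum_max X nrm n a x"
    using equal_weights(1,3)
    by (simp_all only: weighted_max_sum_equal_weights weighted_sum_max_equal_weights)
  moreover have "nrm (T_unweighted X n a x) \<le> unweighted_Hoelder p q X nrm n a x"
    if "p > 1" "1 / p + 1 / q = 1" for p q
    using equal_weights(2)[OF that] weighted_Hoelder_equal_weights[OF n that(2)] by metis
  moreover have "sharp_weighted K weighted_max_sum" "sharp_weighted K weighted_sum_max"
    using sharp_unweighted_max_sum[OF K] sharp_unweighted_sum_max[OF K]
    by (auto intro: sharp_weighted_of_unweighted
        weighted_max_sum_equal_weights weighted_sum_max_equal_weights)
  moreover have "sharp_weighted K (weighted_Hoelder p q)" if "p > 1" "1 / p + 1 / q = 1" for p q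
    by (rule sharp_weighted_of_unweighted[where R' = "unweighted_Hoelder p q"])
      (use that sharp_unweighted_Hoelder[OF K] weighted_Hoelder_equal_weights in auto)
  ultimately show ?thesis
    using bounds sharp_unweighted_max_sum[OF K] sharp_unweighted_Hoelder[OF K]
      sharp_unweighted_sum_max[OF K]
    by auto
qed

end
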